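(* Let $s_*\ge 0$ and let $T:[s_*,\infty)\to[0,1)$ be a differentiable function (one-sided at $s_*$). Then the one-parameter family $\left\{\mathfrak{A}_s^{T(s)}:\ s\ge s_*\right\}$ is a filtration if and only if $$T'(s)\le(1-T(s))\,\frac{\xi_0(s)}{s}\qquad\text{for all } s>s_*.$$
   Context: Let $\mathbb{D}=\{z\in\mathbb{C}:|z|<1\}$ and let $\mathcal{A}$ be the set of all holomorphic functions $f$ on $\mathbb{D}$ with $f(0)=0$ and $f'(0)=1$. For $s\in[0,\infty)$ and $t\in[0,1]$ define $$\mathfrak{A}_s^t:=\left\{f\in\mathcal{A}:\ \Re\left[(s-1)\frac{f(z)}{z}+f'(z)\right]\ge st\ \text{ for all } z\in\mathbb{D}\setminus\{0\}\right\}.$$ The function $\xi_0$ is defined for $s>0$ by $\xi_0(s)=\int_0^1\frac{1-x}{1+x}\,s\,x^{s-1}\,dx$. A one-parameter family of sets $\{\mathfrak{F}_s\}$ is called a filtration if $\mathfrak{F}_{s}\subset\mathfrak{F}_{s'}$ whenever $s<s'$. *)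

theory Defs
  imports "HOL-Complex_Analysis.Complex_Analysis"
begin

(* Functions on the unit disc are represented by total functions on the complex plane;
   the classes below constrain only the values on the disc. *)
definition class_A :: "(complex \<Rightarrow> complex) set" where
  "class_A = {f. f holomorphic_on ball 0 1 \<and> f 0 = 0 \<and> deriv f 0 = 1}"

definition frakA :: "real \<Rightarrow> real \<Rightarrow> (complex \<Rightarrow> complex) set" where
  "frakA s t = {f \<in> class_A. \<forall>z \<in> ball 0 1 - {0}.
      Re (complex_of_real (s - 1) * (f z / z) + deriv f z) \<ge> s * t}"

(* Meaningful for s > 0; for 0 < s < 1 the integrand is unbounded near 0 but still integrable. *)
definition xi0 :: "real \<Rightarrow> real" where
  "xi0 s = integral {0..1} (\<lambda>x. (1 - x) / (1 + x) * (s * x powr (s - 1)))"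

(* Inclusions are not required to be proper. *)
definition filtration_on :: "real set \<Rightarrow> (real \<Rightarrow> 'a set) \<Rightarrow> bool" where
  "filtration_on I F \<longleftrightarrow> (\<forall>s\<in>I. \<forall>s'\<in>I. s < s' \<longrightarrow> F s \<subseteq> F s')"

end

theory Submission
  imports Defs
begin

text \<open>
  Write \<open>f z = z * g z\<close> and \<open>p z = s * g z + z * deriv g z\<close>.  Then membership of \<open>f\<close> in
  \<open>frakA s t\<close> says \<open>Re p \<ge> s * t\<close>, and \<open>g\<close> is recovered from \<open>p\<close> as a weighted mean along rays,
  \<open>g z = \<integral>\<^sub>0\<^sup>1 x powr (s - 1) * p (x * z) dx\<close>.  Since \<open>p 0 = s\<close>, Harnack's inequality bounds \<open>Re p\<close>
  from below on every circle, and integration gives \<open>Re g \<ge> t + (1 - t) * xi0 s\<close>.  The same function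
  (with \<open>p\<close> the half-plane map sending \<open>-1\<close> to \<open>s * t\<close>) is extremal for both bounds at once, so for
  \<open>u > s\<close> the infimum of \<open>Re (u * g z + z * deriv g z) = (u - s) * Re (g z) + Re (p z)\<close> over the class
  is known exactly.  This yields a sharp criterion for a single inclusion: the defect \<open>1 - t\<close> has to
  shrink at most by the factor \<open>contraction s u = 1 - (1 - s / u) * xi0 s\<close>
  (lemma \<open>frakA_subset_iff\<close>).

  Letting \<open>u\<close> tend to \<open>s\<close> in this criterion gives the differential inequality for a filtration.
  For the converse, the differential inequality has to be integrated to the criterion for all
  pairs, for which one needs that the criterion for distant parameters is implied by its
  infinitesimal form.  That is a property of \<open>xi0\<close> alone, and it comes out of the sharpness:
  composing two inclusions gives an inclusion, so that
  \<open>contraction s v \<le> contraction s u * contraction u v\<close>, which amounts to a bound for the logarithmic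
  derivative of \<open>u \<mapsto> contraction s u\<close> by \<open>- xi0 u / u\<close> (lemma \<open>contraction_mult_xi0_le\<close>).  Hence
  \<open>(1 - T u) / contraction s u\<close> is nondecreasing in \<open>u\<close>, and it equals \<open>1 - T s\<close> at \<open>u = s\<close>.
\<close>

section \<open>The weighted mean\<close>

lemma class_A_factor:
  assumes "f \<in> class_A"
  obtains g where "g holomorphic_on ball 0 1" and "g 0 = 1"
    and "\<And>z. z \<in> ball 0 1 \<Longrightarrow> f z = z * g z"
    and "\<And>z. z \<in> ball 0 1 \<Longrightarrow> deriv f z = g z + z * deriv g z"
proof
  define g where "g = (\<lambda>z. if z = 0 then deriv f 0 else (f z - f 0) / (z - 0))"
  have f: "f holomorphic_on ball 0 1" "f 0 = 0" "deriv f 0 = 1"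
    using assms by (auto simp: class_A_def)
  show g: "g holomorphic_on ball 0 1"
    unfolding g_def by (rule pole_lemma) (use f in auto)
  show "g 0 = 1" by (simp add: g_def f)
  show fg: "f z = z * g z" if "z \<in> ball 0 1" for z
    by (simp add: g_def f)
  show "deriv f z = g z + z * deriv g z" if z: "z \<in> ball 0 1" for z
  proof -
    have "((\<lambda>z. z * g z) has_field_derivative g z + z * deriv g z) (at z)"
      using holomorphic_derivI[OF g _ z] by (auto intro!: derivative_eq_intros)
    then have "(f has_field_derivative g z + z * deriv g z) (at z)"
      by (rule has_field_derivative_transform_within_open[where S = "ball 0 1"]) (use z fg in auto)
    then show ?thesis by (rule DERIV_imp_deriv)
  qed
qed

text \<open>
  In terms of \<open>g\<close> the condition extends to the origin: there the expression takes the value \<open>s \<ge> s * t\<close>.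
\<close>

lemma frakA_factor_iff:
  assumes "g holomorphic_on ball 0 1" and "g 0 = 1"
    and fg: "\<And>z. z \<in> ball 0 1 \<Longrightarrow> f z = z * g z"
    and df: "\<And>z. z \<in> ball 0 1 \<Longrightarrow> deriv f z = g z + z * deriv g z"
    and "f \<in> class_A" and "s \<ge> 0" and "t \<le> 1"
  shows "f \<in> frakA s t \<longleftrightarrow>
    (\<forall>z \<in> ball 0 1. Re (of_real s * g z + z * deriv g z) \<ge> s * t)"
proof -
  have eq: "of_real (s - 1) * (f z / z) + deriv f z = of_real s * g z + z * deriv g z"
    if "z \<in> ball 0 1 - {0}" for z
    using that fg[of z] df[of z] by (simp add: algebra_simps)
  have "s * t \<le> s" using assms by (simp add: mult_left_le)
  then have zero: "Re (of_real s * g 0 + 0 * deriv g 0) \<ge> s * t"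
    using assms by simp
  have "f \<in> frakA s t \<longleftrightarrow>
      (\<forall>z \<in> ball 0 1 - {0}. Re (of_real s * g z + z * deriv g z) \<ge> s * t)"
    unfolding frakA_def using \<open>f \<in> class_A\<close> by (simp only: mem_Collect_eq eq cong: ball_cong) simp
  also have "\<dots> \<longleftrightarrow> (\<forall>z \<in> ball 0 1. Re (of_real s * g z + z * deriv g z) \<ge> s * t)"
    using zero by (metis DiffE DiffI singletonD)
  finally show ?thesis .
qed

text \<open>
  The Cayley transform \<open>(q - 1) / (q + 1)\<close> maps into the closed disc and fixes the origin, so this is
  the Schwarz lemma.  To land in the open disc, the transform is taken of \<open>(q + e) / (1 + e)\<close> and
  \<open>e\<close> is sent to zero.
\<close>

lemma Harnack_lower:
  assumes holo: "q holomorphic_on ball 0 1" and pos: "\<And>z. z \<in> ball 0 1 \<Longrightarrow> Re (q z) \<ge> 0"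
    and q0: "q 0 = 1" and w: "w \<in> ball 0 1"
  shows "Re (q w) \<ge> (1 - norm w) / (1 + norm w)"
proof (rule field_le_epsilon)
  fix e :: real assume "e > 0"
  define h where "h = (\<lambda>z. (q z - 1) / (q z + 1 + 2 * of_real e))"
  have nz: "q z + 1 + 2 * of_real e \<noteq> 0" if "z \<in> ball 0 1" for z
    using pos[OF that] \<open>e > 0\<close> by (auto simp: complex_eq_iff)
  have "norm (h z) < 1" if "norm z < 1" for z
  proof -
    have p: "Re (q z) \<ge> 0" using pos[of z] that by simp
    have "norm (q z - 1) ^ 2 < norm (q z + 1 + 2 * of_real e) ^ 2"
      unfolding cmod_power2 using p \<open>e > 0\<close>
      by (simp add: power2_eq_square algebra_simps add_pos_nonneg)
    then have "norm (q z - 1) < norm (q z + 1 + 2 * of_real e)"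
      by (rule power2_less_imp_less) simp
    then show ?thesis using nz[of z] that by (simp add: h_def norm_divide)
  qed
  moreover have "h holomorphic_on ball 0 1"
    unfolding h_def using nz by (intro holomorphic_intros holo) auto
  moreover have "h 0 = 0" by (simp add: h_def q0)
  ultimately have "norm (h w) \<le> norm w"
    using Schwarz_Lemma(1)[of h w] w by simp
  then have "norm (q w - 1) \<le> norm w * norm (q w + 1 + 2 * of_real e)"
    using nz[OF w] by (simp add: h_def norm_divide field_simps)
  define r a b where "r = norm w" and "a = Re (q w)" and "b = Im (q w)"
  have r: "0 \<le> r" "r < 1" using w by (auto simp: r_def)
  have "norm (q w - 1) ^ 2 \<le> (r * norm (q w + 1 + 2 * of_real e)) ^ 2"
    using \<open>norm (q w - 1) \<le> _\<close> by (simp add: r_def)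
  then have "(a - 1)^2 + b^2 \<le> r^2 * ((a + 1 + 2 * e)^2 + b^2)"
    unfolding power_mult_distrib cmod_power2 by (simp add: a_def b_def)
  \<comment> \<open>The imaginary part contributes more on the left than on the right and can be dropped.\<close>
  moreover have "r^2 * b^2 \<le> b^2"
    using r by (intro mult_left_le_one_le) (auto simp: power_le_one)
  ultimately have "(a - 1)^2 \<le> (r * (a + 1 + 2 * e))^2"
    unfolding power_mult_distrib distrib_left[of "r^2"] by linarith
  moreover have "0 \<le> r * (a + 1 + 2 * e)"
    using r pos[OF w] \<open>e > 0\<close> by (simp add: a_def)
  ultimately have "\<bar>a - 1\<bar> \<le> r * (a + 1 + 2 * e)"
    by (metis abs_le_square_iff abs_of_nonneg)
  then have "1 - r \<le> a * (1 + r) + 2 * e * r" by (simp add: algebra_simps abs_le_iff)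
  also have "2 * e * r \<le> e * (1 + r)"
    using r \<open>e > 0\<close> by (simp add: algebra_simps)
  finally have "1 - r \<le> (a + e) * (1 + r)" by (simp add: algebra_simps)
  then show "(1 - norm w) / (1 + norm w) \<le> Re (q w) + e"
    using r unfolding r_def a_def by (subst pos_divide_le_eq) (auto intro: add_pos_nonneg)
qed

lemma ray_derivative:
  assumes g: "g holomorphic_on ball 0 1" and z: "z \<in> ball 0 1" and x: "0 \<le> x" "x \<le> 1"
  shows "((\<lambda>x. Re (g (of_real x * z))) has_real_derivative Re (z * deriv g (of_real x * z))) (at x)"
proof -
  have "norm (of_real x * z) \<le> norm z"
    using x by (simp add: norm_mult mult_left_le_one_le)
  then have "of_real x * z \<in> ball 0 1" using z by simp
  note d = holomorphic_derivI[OF g _ this]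
  have "((\<lambda>x. g (of_real x * z)) has_vector_derivative (z * deriv g (of_real x * z))) (at x)"
    using field_vector_diff_chain_at[of "\<lambda>x. of_real x * z" z x g, OF _ d]
      has_vector_derivative_mult_left[OF has_vector_derivative_of_real[OF DERIV_ident], of z "at x"]
    by (simp add: o_def)
  then show ?thesis
    unfolding has_real_derivative_iff_has_vector_derivative
    using bounded_linear.has_vector_derivative[OF bounded_linear_Re] by blast
qed

text \<open>
  The integrand is the derivative of \<open>x powr s * Re (g (x * z))\<close>, which vanishes at \<open>x = 0\<close>.
\<close>

lemma weighted_mean:
  assumes g: "g holomorphic_on ball 0 1" and z: "z \<in> ball 0 1" and s: "s > 0"
  shows "((\<lambda>x. x powr (s - 1) * Re (of_real s * g (of_real x * z)
            + of_real x * z * deriv g (of_real x * z))) has_integral Re (g z)) {0..1}"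
proof -
  let ?F = "\<lambda>x. x powr s * Re (g (of_real x * z))"
  have "continuous_on {0..1} (\<lambda>x. Re (g (of_real x * z)))"
    by (rule DERIV_continuous_on) (rule DERIV_subset[OF ray_derivative[OF g z]], auto)
  moreover have "continuous_on {0..1} (\<lambda>x. x powr s)"
    using s by (intro continuous_on_powr' continuous_intros) auto
  ultimately have cont: "continuous_on {0..1} ?F"
    by (intro continuous_on_mult)
  have "(?F has_vector_derivative x powr (s - 1) * Re (of_real s * g (of_real x * z)
          + of_real x * z * deriv g (of_real x * z))) (at x)" if "x \<in> {0<..<1}" for x
  proof -
    have "(?F has_real_derivative s * x powr (s - 1) * Re (g (of_real x * z))
            + x powr s * Re (z * deriv g (of_real x * z))) (at x)"
      using that DERIV_mult[OF has_real_derivative_powr[of x s] ray_derivative[OF g z, of x]]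
      by (simp add: mult.commute add.commute)
    moreover have "x powr s = x powr (s - 1) * x"
      using that by (simp add: powr_diff)
    ultimately show ?thesis
      by (simp add: has_real_derivative_iff_has_vector_derivative algebra_simps)
  qed
  from fundamental_theorem_of_calculus_interior[OF _ cont this]
  show ?thesis by simp
qed

lemma power_weight_has_integral:
  fixes s :: real
  assumes "s > 0"
  shows "((\<lambda>x. s * x powr (s - 1)) has_integral 1) {0..1}"
  using weighted_mean[of "\<lambda>_. 1" 0 s] assms by (simp add: mult.commute)

lemma xi0_has_integral:
  assumes "s > 0"
  shows "((\<lambda>x. (1 - x) / (1 + x) * (s * x powr (s - 1))) has_integral xi0 s) {0..1}"
proof -
  have "(\<lambda>x. s * x powr (s - 1)) absolutely_integrable_on {0..1}"
    by (rule nonnegative_absolutely_integrable_1)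
       (use power_weight_has_integral[OF assms] assms in auto)
  moreover have c: "continuous_on {0..1} (\<lambda>x::real. (1 - x) / (1 + x))"
    by (intro continuous_intros) auto
  ultimately have "(\<lambda>x. (1 - x) / (1 + x) * (s * x powr (s - 1))) absolutely_integrable_on {0..1}"
    by - (rule absolutely_integrable_bounded_measurable_product_real
,
        auto intro!: integrable_imp_measurable integrable_continuous_real
          compact_imp_bounded compact_continuous_image)
  then show ?thesis
    unfolding xi0_def by (intro integrable_integral set_lebesgue_integral_eq_integral(1))
qed

lemma xi0_le_1:
  assumes "s > 0"
  shows "xi0 s \<le> 1"
proof (rule has_integral_le[OF xi0_has_integral power_weight_has_integral])
  fix x :: real assume "x \<in> {0..1}"
  then have "(1 - x) / (1 + x) \<le> 1" by simp
  then show "(1 - x) / (1 + x) * (s * x powr (s - 1)) \<le> s * x powr (s - 1)"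
    using assms by (intro mult_left_le_one_le) (use \<open>x \<in> _\<close> in auto)
qed (use assms in auto)

lemma affine_xi0_has_integral:
  assumes "s > 0"
  shows "((\<lambda>x. x powr (s - 1) * (s * (a + b * ((1 - x) / (1 + x))))) has_integral (a + b * xi0 s)) {0..1}"
proof -
  have "((\<lambda>x. a * (s * x powr (s - 1)) + b * ((1 - x) / (1 + x) * (s * x powr (s - 1))))
          has_integral (a * 1 + b * xi0 s)) {0..1}"
    by (intro has_integral_add has_integral_mult_right xi0_has_integral power_weight_has_integral assms)
  then show ?thesis by (simp add: algebra_simps)
qed

text \<open>
  Harnack's inequality for \<open>q = (p - s * t) / (s * (1 - t))\<close>, where \<open>p = s * g + z * deriv g\<close>, bounds
  the integrand of the weighted mean pointwise by the integrand that defines \<open>xi0\<close>.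
\<close>

lemma mean_lower_bound:
  assumes g: "g holomorphic_on ball 0 1" and g0: "g 0 = 1" and s: "s > 0" and t: "t < 1"
    and bd: "\<And>z. z \<in> ball 0 1 \<Longrightarrow> Re (of_real s * g z + z * deriv g z) \<ge> s * t"
    and z: "z \<in> ball 0 1"
  shows "Re (g z) \<ge> t + (1 - t) * xi0 s"
proof (rule has_integral_le[OF affine_xi0_has_integral[OF s] weighted_mean[OF g z s]])
  fix x :: real assume x: "x \<in> {0..1}"
  define q where "q = (\<lambda>z. (of_real s * g z + z * deriv g z - of_real (s * t)) / of_real (s * (1 - t)))"
  define w where "w = of_real x * z"
  have nw: "norm w \<le> x" using x z by (simp add: w_def norm_mult mult_left_le)
  have w: "w \<in> ball 0 1"
  proof -
    have "norm w \<le> norm z" using x by (simp add: w_def norm_mult mult_left_le_one_le)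
    then show ?thesis using z by simp
  qed
  have c: "s * (1 - t) > 0" using s t by simp
  have Req: "Re (q v) = (Re (of_real s * g v + v * deriv g v) - s * t) / (s * (1 - t))" for v
    unfolding q_def by (simp only: Re_divide_of_real minus_complex.sel Re_complex_of_real)
  have "Re (q w) \<ge> (1 - norm w) / (1 + norm w)"
  proof (rule Harnack_lower)
    show "q holomorphic_on ball 0 1"
      unfolding q_def using s t by (intro holomorphic_intros g holomorphic_deriv) auto
    show "Re (q v) \<ge> 0" if "v \<in> ball 0 1" for v
      unfolding Req using bd[OF that] c by (intro divide_nonneg_pos) auto
    show "q 0 = 1"
      using s t by (simp add: q_def g0 field_simps)
  qed (rule w)
  moreover have "(1 - x) / (1 + x) \<le> (1 - norm w) / (1 + norm w)"
    using nw x by (intro frac_le) (auto intro: add_pos_nonneg)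
  ultimately have "(1 - x) / (1 + x) \<le> Re (q w)" by linarith
  then have "(1 - x) / (1 + x) * (s * (1 - t)) \<le> Re (of_real s * g w + w * deriv g w) - s * t"
    unfolding Req using c by (simp only: pos_le_divide_eq)
  then have "s * (t + (1 - t) * ((1 - x) / (1 + x))) \<le> Re (of_real s * g w + w * deriv g w)"
    by (simp add: algebra_simps)
  then show "x powr (s - 1) * (s * (t + (1 - t) * ((1 - x) / (1 + x))))
      \<le> x powr (s - 1) * Re (of_real s * g (of_real x * z) + of_real x * z * deriv g (of_real x * z))"
    unfolding w_def by (intro mult_left_mono) auto
qed

section \<open>The extremal function\<close>

text \<open>
  Solving \<open>s * F + z * deriv F = s / (1 - z)\<close> coefficientwise gives the series with coefficients
  \<open>s / (s + n)\<close>; the wanted \<open>g\<close> is an affine image of \<open>F\<close>, because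
  \<open>(1 + z) / (1 - z) = 2 / (1 - z) - 1\<close>.
\<close>

lemma extremal_function:
  assumes s: "s > 0"
  obtains g where "g holomorphic_on ball 0 1" and "g 0 = 1"
    and "\<And>z. z \<in> ball 0 1 \<Longrightarrow> of_real s * g z + z * deriv g z
           = of_real s * (of_real t + of_real (1 - t) * ((1 + z) / (1 - z)))"
proof
  define a :: "nat \<Rightarrow> complex" where "a n = of_real (s / (s + real n))" for n
  define F where "F z = (\<Sum>n. a n * z ^ n)" for z
  have a_le: "norm (a n) \<le> 1" for n using s unfolding a_def norm_of_real by simp
  have summ: "summable (\<lambda>n. a n * z ^ n)" if "norm z < 1" for z
  proof (rule summable_comparison_test'[where N = 0])
    show "summable (\<lambda>n. norm z ^ n)" using that by (simp add: summable_geometric)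
    show "norm (a n * z ^ n) \<le> norm z ^ n" for n
      using a_le[of n] by (simp add: norm_mult norm_power mult_left_le_one_le)
  qed
  have DF: "(F has_field_derivative (\<Sum>n. diffs a n * z ^ n)) (at z)" if "norm z < 1" for z
  proof -
    obtain K where K: "norm z < K" "K < 1" using dense \<open>norm z < 1\<close> by blast
    have "norm z < norm (of_real K :: complex)" "norm (of_real K :: complex) < 1" using K norm_ge_zero[of z] by (auto simp del: norm_ge_zero)
    then show ?thesis
      unfolding F_def by (intro termdiffs_strong[where K = "of_real K"] summ)
  qed
  have F_eq: "of_real s * F z + z * deriv F z = of_real s / (1 - z)" if "norm z < 1" for z
  proof -
    have dF: "deriv F z = (\<Sum>n. diffs a n * z ^ n)" using DF[OF that] by (rule DERIV_imp_deriv)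
    have "summable (\<lambda>n. diffs a n * z ^ n)"
      by (rule termdiff_converges[OF that summ])
    from diffs_equiv[OF this] have "(\<lambda>n. of_nat n * a n * z ^ (n - Suc 0)) sums deriv F z"
      by (simp add: dF)
    from sums_mult[OF this, of z]
    have "(\<lambda>n. of_nat n * a n * z ^ n) sums (z * deriv F z)"
    proof (rule sums_cong[THEN iffD1, rotated])
      show "z * (of_nat n * a n * z ^ (n - Suc 0)) = of_nat n * a n * z ^ n" for n
        by (cases n) auto
    qed
    moreover have "(\<lambda>n. of_real s * (a n * z ^ n)) sums (of_real s * F z)"
      unfolding F_def by (intro sums_mult summable_sums summ that)
    ultimately have "(\<lambda>n. of_real s * (a n * z ^ n) + of_nat n * a n * z ^ n)
        sums (of_real s * F z + z * deriv F z)"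
      by (intro sums_add)
    moreover have "of_real s * (a n * z ^ n) + of_nat n * a n * z ^ n = of_real s * z ^ n" for n
    proof -
      have "s + real n \<noteq> 0" using s by (simp add: add_pos_nonneg less_imp_neq[symmetric])
      then have "s * (s / (s + real n)) + real n * (s / (s + real n)) = s"
        by (simp flip: add_divide_distrib distrib_right)
      then have "of_real s * a n + of_nat n * a n = of_real s"
        unfolding a_def by (metis of_real_add of_real_mult of_real_of_nat_eq)
      then show ?thesis by (metis (no_types, lifting) distrib_right mult.assoc)
    qed
    ultimately have "(\<lambda>n. of_real s * z ^ n) sums (of_real s * F z + z * deriv F z)" by simp
    moreover have "(\<lambda>n. of_real s * z ^ n) sums (of_real s * (1 / (1 - z)))"
      by (intro sums_mult geometric_sums that)
    ultimately show ?thesis using sums_unique2 by fastforce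
  qed
  define g where "g z = of_real t + of_real (1 - t) * (2 * F z - 1)" for z
  have Dg: "(g has_field_derivative of_real (1 - t) * (2 * deriv F z)) (at z)" if "norm z < 1" for z
    unfolding g_def using DF[OF that] DERIV_imp_deriv[OF DF[OF that]]
    by (auto intro!: derivative_eq_intros)
  show "g holomorphic_on ball 0 1"
    unfolding holomorphic_on_open[OF open_ball] using Dg by (metis mem_ball_0)
  have "F 0 = 1" using s by (simp add: F_def powser_zero) (simp add: a_def)
  then show "g 0 = 1" by (simp add: g_def)
  show "of_real s * g z + z * deriv g z
           = of_real s * (of_real t + of_real (1 - t) * ((1 + z) / (1 - z)))"
    if "z \<in> ball 0 1" for z
  proof -
    have z: "norm z < 1" "1 - z \<noteq> 0" using that by auto
    have "of_real s * g z + z * deriv g z = of_real s * of_real t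
        + of_real (1 - t) * (2 * (of_real s * F z + z * deriv F z) - of_real s)"
      unfolding DERIV_imp_deriv[OF Dg[OF z(1)]] by (simp add: g_def algebra_simps)
    also have "2 * (of_real s * F z + z * deriv F z) - of_real s = of_real s * ((1 + z) / (1 - z))"
      unfolding F_eq[OF z(1)] using z(2) by (simp add: field_simps)
    finally show ?thesis by (simp add: algebra_simps)
  qed
qed

text \<open>
  Towards \<open>-1\<close> the extremal function attains the lower bound of \<open>mean_lower_bound\<close> in the limit.
  The explicit error term, coming from the Lipschitz bound \<open>2 * (1 - x)\<close> for
  \<open>(1 - x * y) / (1 + x * y) - (1 - y) / (1 + y)\<close>, avoids a limit under the integral.
\<close>

lemma mean_of_extremal:
  assumes g: "g holomorphic_on ball 0 1" and s: "s > 0" and t: "t < 1"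
    and eq: "\<And>z. z \<in> ball 0 1 \<Longrightarrow> of_real s * g z + z * deriv g z
           = of_real s * (of_real t + of_real (1 - t) * ((1 + z) / (1 - z)))"
    and x: "0 < x" "x < 1"
  shows "Re (g (- of_real x)) \<le> t + (1 - t) * (xi0 s + 2 * (1 - x))"
proof -
  have "Re (g (- of_real x)) \<le> (t + 2 * (1 - t) * (1 - x)) + (1 - t) * xi0 s"
  proof (rule has_integral_le[OF weighted_mean[OF g _ s] affine_xi0_has_integral[OF s]])
    show "- of_real x \<in> ball (0::complex) 1" using x by simp
    fix y :: real assume y: "y \<in> {0..1}"
    define w where "w = of_real y * (- of_real x :: complex)"
    have w: "w = of_real (- (x * y))" by (simp add: w_def)
    have xy: "0 \<le> x * y" "x * y < 1"
      using x y by (auto intro: order_le_less_trans[OF mult_left_le])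
    have "w \<in> ball 0 1" using xy by (simp add: w norm_mult)
    then have "of_real s * g w + w * deriv g w
        = of_real (s * (t + (1 - t) * ((1 - x * y) / (1 + x * y))))"
      by (subst eq) (simp_all add: w)
    then have 1: "Re (of_real s * g w + w * deriv g w) = s * (t + (1 - t) * ((1 - x * y) / (1 + x * y)))"
      by (simp only: Re_complex_of_real)
    have pos: "0 < (1 + x * y) * (1 + y)" "1 \<le> (1 + x * y) * (1 + y)"
      using xy y mult_mono[of 1 "1 + x * y" 1 "1 + y"] by auto
    have "(1 - x * y) / (1 + x * y) - (1 - y) / (1 + y) = 2 * y * (1 - x) / ((1 + x * y) * (1 + y))"
      using xy y by (simp add: field_simps)
    also have "\<dots> \<le> 2 * y * (1 - x) / 1"
      using pos x y by (intro divide_left_mono) auto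
    also have "\<dots> \<le> 2 * (1 - x)"
    proof -
      have "y * (1 - x) \<le> 1 - x" using x y by (simp add: mult_left_le_one_le)
      then show ?thesis unfolding mult.assoc div_by_1 by (rule mult_left_mono) simp
    qed
    finally have "(1 - t) * ((1 - x * y) / (1 + x * y)) \<le> (1 - t) * ((1 - y) / (1 + y) + 2 * (1 - x))"
      using t by (intro mult_left_mono) auto
    then have "Re (of_real s * g w + w * deriv g w)
        \<le> s * (t + 2 * (1 - t) * (1 - x) + (1 - t) * ((1 - y) / (1 + y)))"
      unfolding 1 using s by (intro mult_left_mono) (auto simp: algebra_simps)
    then show "y powr (s - 1) * Re (of_real s * g (of_real y * - of_real x)
          + of_real y * - of_real x * deriv g (of_real y * - of_real x))
        \<le> y powr (s - 1) * (s * (t + 2 * (1 - t) * (1 - x) + (1 - t) * ((1 - y) / (1 + y))))"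
      unfolding w_def by (intro mult_left_mono) auto
  qed
  then show ?thesis by (simp add: algebra_simps)
qed

section \<open>Inclusions between two classes\<close>

text \<open>
  The smallest ratio \<open>(1 - t') / (1 - t)\<close> for which \<open>frakA s t \<subseteq> frakA u t'\<close>.  It does not depend on
  \<open>t\<close>, because changing \<open>t\<close> acts on the functions \<open>s * g + z * deriv g\<close> of the class as a dilation
  with centre \<open>s\<close>.
\<close>

definition contraction :: "real \<Rightarrow> real \<Rightarrow> real" where
  "contraction s u = 1 - (1 - s / u) * xi0 s"

lemma contraction_pos:
  assumes "0 < s" "s \<le> u"
  shows "contraction s u > 0"
proof -
  have "(1 - s / u) * xi0 s \<le> 1 - s / u"
    using xi0_le_1[of s] assms by (intro mult_left_le) auto
  moreover have "s / u > 0" using assms by auto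
  ultimately show ?thesis unfolding contraction_def by linarith
qed

text \<open>
  Since \<open>u * g + z * deriv g = (u - s) * g + (s * g + z * deriv g)\<close>, the largest admissible \<open>t'\<close> comes
  from adding the lower bounds for the two summands.  The extremal function approaches both of them
  as \<open>z\<close> tends to \<open>-1\<close> along the real axis, so nothing is lost.
\<close>

lemma frakA_subset_iff:
  assumes s: "0 < s" "s < u" and t: "t < 1" "t' < 1"
  shows "frakA s t \<subseteq> frakA u t' \<longleftrightarrow> (1 - t) * contraction s u \<le> 1 - t'"
proof -
  have crit: "(1 - t) * contraction s u \<le> 1 - t' \<longleftrightarrow>
      u * t' \<le> (u - s) * (t + (1 - t) * xi0 s) + s * t"
  proof -
    have "u * (1 - t' - (1 - t) * contraction s u) = (u - s) * (t + (1 - t) * xi0 s) + s * t - u * t'"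
      using s by (simp add: contraction_def field_simps)
    moreover have "0 \<le> u * (1 - t' - (1 - t) * contraction s u) \<longleftrightarrow> (1 - t) * contraction s u \<le> 1 - t'"
      using s by (simp add: zero_le_mult_iff)
    ultimately show ?thesis by auto
  qed
  show ?thesis unfolding crit
  proof
    assume le: "u * t' \<le> (u - s) * (t + (1 - t) * xi0 s) + s * t"
    show "frakA s t \<subseteq> frakA u t'"
    proof
      fix f assume f: "f \<in> frakA s t"
      then have fA: "f \<in> class_A" by (simp add: frakA_def)
      then obtain g where g: "g holomorphic_on ball 0 1" "g 0 = 1"
        "\<And>z. z \<in> ball 0 1 \<Longrightarrow> f z = z * g z"
        "\<And>z. z \<in> ball 0 1 \<Longrightarrow> deriv f z = g z + z * deriv g z"
        using class_A_factor by blast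
      have p: "Re (of_real s * g z + z * deriv g z) \<ge> s * t" if "z \<in> ball 0 1" for z
        using frakA_factor_iff[OF g fA, of s t] f s t that by auto
      show "f \<in> frakA u t'"
      proof (subst frakA_factor_iff[OF g fA], safe)
        fix z :: complex assume z: "z \<in> ball 0 1"
        have "(u - s) * (t + (1 - t) * xi0 s) \<le> (u - s) * Re (g z)"
          using mean_lower_bound[OF g(1,2) s(1) t(1) p z] s by (intro mult_left_mono) auto
        with le p[OF z] have "u * t' \<le> (u - s) * Re (g z) + Re (of_real s * g z + z * deriv g z)"
          by linarith
        then show "u * t' \<le> Re (of_real u * g z + z * deriv g z)"
          by (simp add: algebra_simps)
      qed (use s t in auto)
    qed
  next
    assume sub: "frakA s t \<subseteq> frakA u t'"
    obtain g where g: "g holomorphic_on ball 0 1" "g 0 = 1"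
      and eq: "\<And>z. z \<in> ball 0 1 \<Longrightarrow> of_real s * g z + z * deriv g z
           = of_real s * (of_real t + of_real (1 - t) * ((1 + z) / (1 - z)))"
      using extremal_function[OF s(1)] by blast
    define f where "f = (\<lambda>z. z * g z)"
    have df: "deriv f z = g z + z * deriv g z" if "z \<in> ball 0 1" for z
      unfolding f_def using holomorphic_derivI[OF g(1) _ that]
      by (auto intro!: DERIV_imp_deriv derivative_eq_intros)
    have fA: "f \<in> class_A"
      using df[of 0] g by (auto simp: class_A_def f_def intro!: holomorphic_intros)
    have fg: "f z = z * g z" if "z \<in> ball 0 1" for z by (simp add: f_def)
    have "f \<in> frakA s t"
    proof (subst frakA_factor_iff[OF g fg df fA], simp_all only:, safe)
      fix z :: complex assume z: "z \<in> ball 0 1"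
      have "Re ((1 + z) / (1 - z)) \<ge> 0"
      proof -
        have "Re ((1 + z) / (1 - z)) = (1 - (norm z)^2) / (norm (1 - z))^2"
          unfolding cmod_power2 by (simp add: Re_divide power2_eq_square algebra_simps)
        moreover have "(norm z)^2 \<le> 1" using z by (simp add: power_le_one)
        ultimately show ?thesis by simp
      qed
      then have "s * (t + (1 - t) * Re ((1 + z) / (1 - z))) \<ge> s * t"
        using s t by (intro mult_left_mono) auto
      then show "s * t \<le> Re (of_real s * g z + z * deriv g z)"
        unfolding eq[OF z] times_divide_eq_right[symmetric] Re_complex_of_real
          by (simp add: Re_complex_of_real del: times_divide_eq_right of_real_diff)
    qed (use s t in auto)
    then have "f \<in> frakA u t'" using sub by blast
    then have ineq: "u * t' \<le> Re (of_real u * g z + z * deriv g z)" if "z \<in> ball 0 1" for z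
      using frakA_factor_iff[OF g fg df fA, of u t'] s t that by auto
    \<comment> \<open>An upper bound for the left-hand side of the membership condition at \<open>z = -x\<close>; it is continuous
      up to \<open>x = 1\<close>, where it becomes the claimed bound.\<close>
    define R where "R x = (u - s) * (t + (1 - t) * (xi0 s + 2 * (1 - x)))
        + s * (t + (1 - t) * ((1 - x) / (1 + x)))" for x :: real
    have "u * t' \<le> R x" if x: "0 < x" "x < 1" for x
    proof -
      let ?z = "- of_real x :: complex"
      have z: "?z \<in> ball 0 1" using x by simp
      have "of_real s * g ?z + ?z * deriv g ?z = of_real (s * (t + (1 - t) * ((1 - x) / (1 + x))))"
        unfolding eq[OF z] by simp
      then have "Re (of_real s * g ?z + ?z * deriv g ?z) = s * (t + (1 - t) * ((1 - x) / (1 + x)))"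
        by (simp only: Re_complex_of_real)
      moreover have "Re (of_real u * g ?z + ?z * deriv g ?z)
          = (u - s) * Re (g ?z) + Re (of_real s * g ?z + ?z * deriv g ?z)"
        by (simp add: algebra_simps)
      moreover have "(u - s) * Re (g ?z) \<le> (u - s) * (t + (1 - t) * (xi0 s + 2 * (1 - x)))"
        using mean_of_extremal[OF g(1) s(1) t(1) eq x] s by (intro mult_left_mono) auto
      ultimately show ?thesis using ineq[OF z] unfolding R_def by linarith
    qed
    then have ev: "eventually (\<lambda>x. u * t' \<le> R x) (at_left 1)"
      using eventually_at_left_real[of 0 "1::real"] by (auto elim: eventually_mono)
    have "isCont R 1" unfolding R_def by (intro continuous_intros) auto
    then have "(R \<longlongrightarrow> R 1) (at_left 1)"
      unfolding isCont_def by (rule filterlim_at_split[THEN iffD1, THEN conjunct1])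
    from tendsto_lowerbound[OF this ev] have "u * t' \<le> R 1" by simp
    then show "u * t' \<le> (u - s) * (t + (1 - t) * xi0 s) + s * t" by (simp add: R_def)
  qed
qed

text \<open>
  Passing from \<open>s\<close> to \<open>v\<close> through \<open>u\<close> with the optimal parameter at each step is one admissible way of
  passing from \<open>s\<close> to \<open>v\<close>, hence cannot beat the optimal direct inclusion.
\<close>

lemma contraction_supermult:
  assumes "0 < s" "s < u" "u < v"
  shows "contraction s v \<le> contraction s u * contraction u v"
proof -
  let ?t = "1 - contraction s u" and ?t' = "1 - contraction s u * contraction u v"
  have pos: "contraction s u > 0" "contraction u v > 0"
    using assms by (auto intro: contraction_pos)
  have "frakA s 0 \<subseteq> frakA u ?t" "frakA u ?t \<subseteq> frakA v ?t'"
    using assms pos by (subst frakA_subset_iff; simp)+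
  then have "frakA s 0 \<subseteq> frakA v ?t'" by blast
  then show ?thesis using assms pos by (subst (asm) frakA_subset_iff) auto
qed

text \<open>
  The difference \<open>contraction s u * contraction u v - contraction s v\<close> is \<open>1 - u / v\<close> times the
  right-hand side minus the left-hand side, so any single \<open>v > u\<close> will do; here \<open>v = 2 * u\<close>.  Up to the factor
  \<open>- 1 / u\<close>, the right-hand side is the derivative of \<open>contraction s\<close> at \<open>u\<close>.
\<close>

lemma contraction_mult_xi0_le:
  assumes "0 < s" "s < u"
  shows "contraction s u * xi0 u \<le> s * xi0 s / u"
proof -
  define v where "v = 2 * u"
  have "contraction s v \<le> contraction s u * contraction u v"
    using assms by (intro contraction_supermult) (auto simp: v_def)
  moreover have "contraction s v = contraction s u - s * xi0 s / u / 2"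
    using assms by (simp add: contraction_def v_def field_simps)
  moreover have "contraction u v = 1 - xi0 u / 2"
    using assms by (simp add: contraction_def v_def)
  ultimately show ?thesis by (simp add: algebra_simps)
qed

text \<open>
  For \<open>s = 0\<close> the weight of the mean is not integrable, but the condition then says that \<open>Re g\<close>
  increases along rays, so \<open>Re g \<ge> 1\<close>.  (In fact \<open>g\<close> is constant.)
\<close>

lemma frakA_zero_subset:
  assumes "s > 0" "t < 1" "t' < 1"
  shows "frakA 0 t \<subseteq> frakA s t'"
proof
  fix f assume f: "f \<in> frakA 0 t"
  then have fA: "f \<in> class_A" by (simp add: frakA_def)
  then obtain g where g: "g holomorphic_on ball 0 1" "g 0 = 1"
    "\<And>z. z \<in> ball 0 1 \<Longrightarrow> f z = z * g z"
    "\<And>z. z \<in> ball 0 1 \<Longrightarrow> deriv f z = g z + z * deriv g z"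
    using class_A_factor by blast
  have p: "Re (z * deriv g z) \<ge> 0" if "z \<in> ball 0 1" for z
    using frakA_factor_iff[OF g fA, of 0 t] f assms that by auto
  show "f \<in> frakA s t'"
  proof (subst frakA_factor_iff[OF g fA], safe)
    fix z :: complex assume z: "z \<in> ball 0 1"
    have "Re (g (of_real 0 * z)) \<le> Re (g (of_real 1 * z))"
    proof (rule DERIV_nonneg_imp_increasing_open[where f = "\<lambda>x. Re (g (of_real x * z))"])
      show "continuous_on {0..1} (\<lambda>x. Re (g (of_real x * z)))"
        by (rule DERIV_continuous_on) (rule DERIV_subset[OF ray_derivative[OF g(1) z]], auto)
      fix x :: real assume x: "0 < x" "x < 1"
      have "norm (of_real x * z) \<le> norm z"
        using x by (simp add: norm_mult mult_left_le_one_le)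
      then have "0 \<le> Re (of_real x * z * deriv g (of_real x * z))" using z by (intro p) simp
      also have "\<dots> = x * Re (z * deriv g (of_real x * z))"
        by (simp add: algebra_simps)
      finally have "0 \<le> Re (z * deriv g (of_real x * z))"
        using x by (simp add: zero_le_mult_iff)
      then show "\<exists>y. ((\<lambda>x. Re (g (of_real x * z))) has_real_derivative y) (at x) \<and> 0 \<le> y"
        using ray_derivative[OF g(1) z, of x] x by fastforce
    qed simp
    then have "s * 1 \<le> s * Re (g z)" using g(2) assms by (intro mult_left_mono) auto
    moreover have "s * t' \<le> s * 1" using assms by (intro mult_left_mono) auto
    ultimately show "s * t' \<le> Re (of_real s * g z + z * deriv g z)"
      using p[OF z] by simp
  qed (use assms in auto)
qed

section \<open>Filtrations\<close>

theorem theorem4p2: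
  fixes s0 :: real and T :: "real \<Rightarrow> real"
  assumes "s0 \<ge> 0"
    and "\<And>s. s \<ge> s0 \<Longrightarrow> 0 \<le> T s \<and> T s < 1"
    and "T differentiable_on {s0..}"
  shows "filtration_on {s0..} (\<lambda>s. frakA s (T s)) \<longleftrightarrow>
         (\<forall>s > s0. deriv T s \<le> (1 - T s) * (xi0 s / s))"
proof -
  have T1: "T s < 1" if "s \<ge> s0" for s using assms(2) that by blast
  have DT: "(T has_real_derivative deriv T s) (at s)" if "s > s0" for s
  proof -
    have "T differentiable_on {s0<..}"
      using assms(3) by (rule differentiable_on_subset) auto
    then have "T differentiable (at s)"
      using that by (simp add: differentiable_on_eq_differentiable_at)
    then show ?thesis
      using DERIV_deriv_iff_real_differentiable by blast
  qed
  have iff: "frakA s (T s) \<subseteq> frakA u (T u) \<longleftrightarrow> (1 - T s) * contraction s u \<le> 1 - T u"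
    if "0 < s" "s0 \<le> s" "s < u" for s u
    using that T1[of s] T1[of u] by (intro frakA_subset_iff) auto
  show ?thesis
  proof
    assume filt: "filtration_on {s0..} (\<lambda>s. frakA s (T s))"
    show "\<forall>s > s0. deriv T s \<le> (1 - T s) * (xi0 s / s)"
    proof safe
      fix s assume s: "s > s0"
      then have spos: "s > 0" using assms(1) by simp
      have "(T u - T s) / (u - s) \<le> (1 - T s) * (xi0 s / u)" if u: "s < u" for u
      proof -
        have "(1 - T s) * contraction s u \<le> 1 - T u"
          using iff[of s u] filt s u spos by (auto simp: filtration_on_def)
        then have "T u - T s \<le> (1 - T s) * (1 - contraction s u)" by (simp add: algebra_simps)
        also have "1 - contraction s u = (xi0 s / u) * (u - s)"
          using spos u by (simp add: contraction_def field_simps)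
        finally show ?thesis using u by (simp add: pos_divide_le_eq mult.assoc)
      qed
      then have ev: "eventually (\<lambda>u. (T u - T s) / (u - s) \<le> (1 - T s) * (xi0 s / u)) (at_right s)"
        by (auto simp: eventually_at_filter)
      have l1: "((\<lambda>u. (T u - T s) / (u - s)) \<longlongrightarrow> deriv T s) (at_right s)"
        using DERIV_subset[OF DT[OF s], of "{s<..}"] by (simp add: has_field_derivative_iff)
      have l2: "((\<lambda>u. (1 - T s) * (xi0 s / u)) \<longlongrightarrow> (1 - T s) * (xi0 s / s)) (at_right s)"
        using spos by (intro tendsto_intros) auto
      show "deriv T s \<le> (1 - T s) * (xi0 s / s)"
        by (rule tendsto_le[OF _ l2 l1 ev]) simp
    qed
  next
    assume le: "\<forall>s > s0. deriv T s \<le> (1 - T s) * (xi0 s / s)"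
    show "filtration_on {s0..} (\<lambda>s. frakA s (T s))"
      unfolding filtration_on_def
    proof (intro ballI impI)
      fix s v assume sv: "s \<in> {s0..}" "v \<in> {s0..}" "s < v"
      show "frakA s (T s) \<subseteq> frakA v (T v)"
      proof (cases "s = 0")
        case True
        then show ?thesis using sv T1 frakA_zero_subset[of v "T s" "T v"] by simp
      next
        case False
        then have s: "s > 0" using sv assms(1) by simp
        \<comment> \<open>The criterion for \<open>s\<close> and \<open>v\<close> is \<open>h s \<le> h v\<close>.\<close>
        define h where "h u = (1 - T u) / contraction s u" for u
        have "h s \<le> h v"
        proof (rule DERIV_nonneg_imp_increasing_open[where f = h])
          show "continuous_on {s..v} h"
          proof -
            have "continuous_on {s..v} T"
              using differentiable_imp_continuous_on[OF assms(3)] sv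
              by (auto elim: continuous_on_subset)
            moreover have "continuous_on {s..v} (contraction s)"
              unfolding contraction_def using s by (intro continuous_intros) auto
            ultimately show ?thesis
              unfolding h_def using contraction_pos[OF s]
              by (intro continuous_intros) (auto simp: less_le)
          qed
          fix u assume u: "s < u" "u < v"
          let ?c = "contraction s u"
          have c: "?c > 0" using s u by (intro contraction_pos) auto
          have us: "u > s0" "u > 0" using u sv s by auto
          have "(contraction s has_real_derivative - (s * xi0 s / u^2)) (at u)"
            unfolding contraction_def using us
            by (auto intro!: derivative_eq_intros simp: power2_eq_square)
          then have "(h has_real_derivative
              ((1 - T u) * (s * xi0 s / u^2) - deriv T u * ?c) / (?c * ?c)) (at u)"
            unfolding h_def using DT[OF us(1)] c
            by (auto intro!: derivative_eq_intros simp: algebra_simps)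
          moreover have "deriv T u * ?c \<le> (1 - T u) * (s * xi0 s / u^2)"
          proof -
            have "deriv T u * ?c \<le> (1 - T u) * (xi0 u / u) * ?c"
              using le us c by (intro mult_right_mono) auto
            also have "\<dots> = ((1 - T u) / u) * (?c * xi0 u)" by simp
            also have "\<dots> \<le> ((1 - T u) / u) * (s * xi0 s / u)"
              using contraction_mult_xi0_le[OF s u(1)] T1[of u] us
              by (intro mult_left_mono) auto
            also have "\<dots> = (1 - T u) * (s * xi0 s / u^2)" by (simp add: power2_eq_square)
            finally show ?thesis .
          qed
          ultimately show "\<exists>y. (h has_real_derivative y) (at u) \<and> 0 \<le> y"
            using c by (auto intro!: exI divide_nonneg_pos)
        qed (use sv in simp)
        moreover have "contraction s s = 1" using s by (simp add: contraction_def)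
        ultimately have "(1 - T s) * contraction s v \<le> 1 - T v"
          using contraction_pos[OF s, of v] sv by (simp add: h_def pos_le_divide_eq)
        then show ?thesis using iff[OF s] sv by auto
      qed
    qed
  qed
qed

end
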